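(* Let $\boldsymbol{\theta}=(\theta_{1},\dots,\theta_{s})\in\mathbb{R}^{s}$. The foliation $\mathfrak{F}^{\mathrm{poly}}(\boldsymbol{\theta})$ has planar leaves if and only if the coordinates of $\boldsymbol{\theta}$ are algebraically independent (over $\mathbb{Q}$).
   Context: For a real row vector $\boldsymbol{\eta}=(\eta_{1},\dots,\eta_{N})$, the Kronecker foliation $\mathfrak{F}(\boldsymbol{\eta})$ is the foliation of $\mathbb{T}^{N+1}=\mathbb{R}^{N+1}/\mathbb{Z}^{N+1}$ by the cosets of $L(\boldsymbol{\eta})$, the image of the graph $\{(\boldsymbol{x},\boldsymbol{\eta}\cdot\boldsymbol{x})\mid\boldsymbol{x}\in\mathbb{R}^{N}\}$, with the leaf topology (quotient topology from the graph). For $d\geq1$ let $\boldsymbol{\theta}_{d}$ be the vector, of size $N(d)$, whose entries are the values of the monomials $\theta_{1}^{i_{1}}\cdots\theta_{s}^{i_{s}}$ with $0<i_{1}+\cdots+i_{s}\leq d$ (one entry for each multi-index), arranged in dictionary order. The coordinate inclusions $\mathbb{R}^{N(d)}\hookrightarrow\mathbb{R}^{N(d+1)}$ matching the entries indexed by the same monomials (extending by $0$ in the new coordinates) induce monomorphisms $\mathfrak{F}(\boldsymbol{\theta}_{d})\hookrightarrow\mathfrak{F}(\boldsymbol{\theta}_{d+1})$ (identity on the last circle factor), and $$\mathfrak{F}^{\mathrm{poly}}(\boldsymbol{\theta}):=\varinjlim_{d}\mathfrak{F}(\boldsymbol{\theta}_{d}),$$ a foliation of the direct limit torus $\mathbb{T}^{\infty}=\varinjlim\mathbb{T}^{n}$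 whose leaves are the cosets of $\varinjlim_{d}L(\boldsymbol{\theta}_{d})$. The leaves are planar if, with the leaf topology, they are copies of the infinite dimensional vector space $\varinjlim_{d}\mathbb{R}^{N(d)}$ parametrizing them (equivalently, if they are 1-connected). *)

theory Defs
  imports "HOL-Analysis.Analysis" "HOL-Library.Poly_Mapping"
begin

section \<open>The circle \<open>\<real>/\<int>\<close>\<close>

quotient_type circle = real / "\<lambda>x y::real. x - y \<in> \<int>"
  morphisms rep_circle to_circle
proof (rule equivpI)
  show "reflp (\<lambda>x y::real. x - y \<in> \<int>)"
    by (simp add: reflp_def)
  show "symp (\<lambda>x y::real. x - y \<in> \<int>)"
    by (rule sympI) (metis Ints_minus minus_diff_eq)
  show "transp (\<lambda>x y::real. x - y \<in> \<int>)"
    by (rule transpI) (metis Ints_add diff_add_cancel add_diff_eq)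
qed

instantiation circle :: ab_group_add
begin

lift_definition zero_circle :: circle is 0 .

lift_definition plus_circle :: "circle \<Rightarrow> circle \<Rightarrow> circle" is "(+)"
  by (metis Ints_add add_diff_add)

lift_definition uminus_circle :: "circle \<Rightarrow> circle" is uminus
  by (metis Ints_minus minus_diff_minus)

lift_definition minus_circle :: "circle \<Rightarrow> circle \<Rightarrow> circle" is "(-)"
  by (metis Ints_diff diff_diff_eq2 diff_add_eq diff_diff_eq add.commute)

instance
  by standard (transfer; simp add: algebra_simps)+

end

lemma to_circle_eq_iff: "to_circle x = to_circle y \<longleftrightarrow> x - y \<in> \<int>"
  by (rule circle.abs_eq_iff)

lemma to_circle_0 [simp]: "to_circle 0 = 0"
  by (simp add: zero_circle_def)

lemma to_circle_add: "to_circle (x + y) = to_circle x + to_circle y"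
  by (simp add: plus_circle.abs_eq)


section \<open>Quotient topologies and direct limits\<close>

definition quotient_topology :: "'a topology \<Rightarrow> ('a \<Rightarrow> 'b) \<Rightarrow> 'b topology" where
  "quotient_topology X f =
     topology (\<lambda>U. U \<subseteq> f ` topspace X \<and> openin X {x \<in> topspace X. f x \<in> U})"

lemma openin_quotient_topology:
  "openin (quotient_topology X f) U \<longleftrightarrow>
     U \<subseteq> f ` topspace X \<and> openin X {x \<in> topspace X. f x \<in> U}"
proof -
  have "istopology (\<lambda>U. U \<subseteq> f ` topspace X \<and> openin X {x \<in> topspace X. f x \<in> U})"
  proof -
    have *: "{x \<in> topspace X. f x \<in> S \<inter> T} =
        {x \<in> topspace X. f x \<in> S} \<inter> {x \<in> topspace X. f x \<in> T}" for S T
      by auto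
    have **: "{x \<in> topspace X. f x \<in> \<Union>K} = (\<Union>S\<in>K. {x \<in> topspace X. f x \<in> S})" for K
      by auto
    show ?thesis
      unfolding istopology_def * ** by (blast intro: openin_Int)
  qed
  then show ?thesis
    by (simp add: quotient_topology_def topology_inverse')
qed

lemma topspace_quotient_topology [simp]: "topspace (quotient_topology X f) = f ` topspace X"
proof -
  have "{x \<in> topspace X. f x \<in> f ` topspace X} = topspace X"
    by auto
  then have "openin (quotient_topology X f) (f ` topspace X)"
    by (simp add: openin_quotient_topology)
  then show ?thesis
    by (meson openin_quotient_topology openin_subset openin_topspace subset_antisym)
qed

lemma quotient_map_quotient_topology: "quotient_map X (quotient_topology X f) f"
  by (auto simp: quotient_map_def openin_quotient_topology)

text \<open>
  Direct limit of a family of spaces whose transition maps are inclusions of the underlying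
  sets: the union, with the final topology.
\<close>

definition direct_limit :: "'k set \<Rightarrow> ('k \<Rightarrow> 'a topology) \<Rightarrow> 'a topology" where
  "direct_limit A X =
     topology (\<lambda>U. U \<subseteq> (\<Union>k\<in>A. topspace (X k)) \<and> (\<forall>k\<in>A. openin (X k) (U \<inter> topspace (X k))))"

lemma openin_direct_limit:
  "openin (direct_limit A X) U \<longleftrightarrow>
     U \<subseteq> (\<Union>k\<in>A. topspace (X k)) \<and> (\<forall>k\<in>A. openin (X k) (U \<inter> topspace (X k)))"
proof -
  have "istopology (\<lambda>U. U \<subseteq> (\<Union>k\<in>A. topspace (X k)) \<and>
                       (\<forall>k\<in>A. openin (X k) (U \<inter> topspace (X k))))"
  proof -
    have *: "openin Y (S \<inter> T \<inter> topspace Y)"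
      if "openin Y (S \<inter> topspace Y)" "openin Y (T \<inter> topspace Y)" for S T and Y :: "'a topology"
      using openin_Int[OF that] by (simp add: Int_ac)
    have **: "openin Y (\<Union>K \<inter> topspace Y)"
      if "\<And>S. S \<in> K \<Longrightarrow> openin Y (S \<inter> topspace Y)" for K and Y :: "'a topology"
    proof -
      have "openin Y (\<Union>S\<in>K. S \<inter> topspace Y)"
        using that by (intro openin_Union) auto
      then show ?thesis
        by (simp only: Int_Union2)
    qed
    show ?thesis
      unfolding istopology_def by (intro conjI allI impI ballI) (auto intro!: * **)
  qed
  then show ?thesis
    by (simp add: direct_limit_def topology_inverse')
qed

lemma topspace_direct_limit [simp]: "topspace (direct_limit A X) = (\<Union>k\<in>A. topspace (X k))"
proof -
  have "(\<Union>k\<in>A. topspace (X k)) \<inter> topspace (X k) = topspace (X k)" if "k \<in> A" for k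
    using that by auto
  then have "openin (direct_limit A X) (\<Union>k\<in>A. topspace (X k))"
    by (simp add: openin_direct_limit)
  then have "(\<Union>k\<in>A. topspace (X k)) \<subseteq> topspace (direct_limit A X)"
    by (rule openin_subset)
  moreover have "topspace (direct_limit A X) \<subseteq> (\<Union>k\<in>A. topspace (X k))"
    using openin_topspace[of "direct_limit A X"] unfolding openin_direct_limit by (rule conjunct1)
  ultimately show ?thesis
    by (intro subset_antisym)
qed


section \<open>Kronecker foliations\<close>

text \<open>
  Coordinates are labelled by an arbitrary finite set \<open>I\<close> instead of \<open>{1..N}\<close>, and points are
  functions vanishing off the label set, so that extension by zero is literally set inclusion.
  In dimension \<open>N + 1\<close> the labels are \<open>Some i\<close> for \<open>i \<in> I\<close>, and \<open>None\<close> for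
  the last coordinate.
\<close>

definition coord_space :: "'i set \<Rightarrow> ('i \<Rightarrow> real) topology" where
  "coord_space I =
     subtopology (product_topology (\<lambda>_. euclideanreal) UNIV) {x. \<forall>i. i \<notin> I \<longrightarrow> x i = 0}"

definition labels1 :: "'i set \<Rightarrow> 'i option set" where
  "labels1 I = insert None (Some ` I)"

definition torus1 :: "'i set \<Rightarrow> ('i option \<Rightarrow> circle) set" where
  "torus1 I = {p. \<forall>j. j \<notin> labels1 I \<longrightarrow> p j = 0}"

definition kronecker_graph :: "'i set \<Rightarrow> ('i \<Rightarrow> real) \<Rightarrow> ('i option \<Rightarrow> real) set" where
  "kronecker_graph I \<eta> =
     (\<lambda>x. case_option (\<Sum>i\<in>I. \<eta> i * x i) x) ` topspace (coord_space I)"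

text \<open>
  The leaf through \<open>p\<close>: the coset of the image of the graph, carrying the quotient topology
  from the graph rather than the subspace topology of the torus.
\<close>

definition kronecker_leaf ::
    "'i set \<Rightarrow> ('i \<Rightarrow> real) \<Rightarrow> ('i option \<Rightarrow> circle) \<Rightarrow> ('i option \<Rightarrow> circle) topology" where
  "kronecker_leaf I \<eta> p =
     quotient_topology (subtopology (coord_space (labels1 I)) (kronecker_graph I \<eta>))
       (\<lambda>y j. p j + to_circle (y j))"

lemma topspace_coord_space: "topspace (coord_space I) = {x. \<forall>i. i \<notin> I \<longrightarrow> x i = 0}"
  by (simp add: coord_space_def)

lemma kronecker_graph_subset: "kronecker_graph I \<eta> \<subseteq> topspace (coord_space (labels1 I))"
  by (auto simp: kronecker_graph_def labels1_def topspace_coord_space split: option.splits)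

lemma topspace_kronecker_leaf:
  "topspace (kronecker_leaf I \<eta> p) = (\<lambda>y j. p j + to_circle (y j)) ` kronecker_graph I \<eta>"
  using kronecker_graph_subset[of I \<eta>] by (simp add: kronecker_leaf_def Int_absorb1)

lemma kronecker_graph_mono:
  assumes "I \<subseteq> J" "finite J"
  shows "kronecker_graph I \<eta> \<subseteq> kronecker_graph J \<eta>"
proof
  fix y assume "y \<in> kronecker_graph I \<eta>"
  then obtain x where x: "\<forall>i. i \<notin> I \<longrightarrow> x i = 0" and y: "y = case_option (\<Sum>i\<in>I. \<eta> i * x i) x"
    by (auto simp: kronecker_graph_def topspace_coord_space)
  have "(\<Sum>i\<in>I. \<eta> i * x i) = (\<Sum>i\<in>J. \<eta> i * x i)"
    using assms x by (intro sum.mono_neutral_left) auto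
  then show "y \<in> kronecker_graph J \<eta>"
    using x y assms by (auto simp: kronecker_graph_def topspace_coord_space)
qed

lemma continuous_map_kronecker_leaf_inclusion:
  assumes "I \<subseteq> J" "finite J"
  shows "continuous_map (kronecker_leaf I \<eta> p) (kronecker_leaf J \<eta> p) id"
proof -
  let ?G = "\<lambda>I. subtopology (coord_space (labels1 I)) (kronecker_graph I \<eta>)"
  let ?f = "\<lambda>y j. p j + to_circle (y j)"
  have G: "?G I = subtopology (product_topology (\<lambda>_. euclideanreal) UNIV) (kronecker_graph I \<eta>)" for I
    using kronecker_graph_subset[of I \<eta>]
    by (simp add: coord_space_def subtopology_subtopology Int_absorb1)
  have "continuous_map (?G I) (?G J) id"
    unfolding G using kronecker_graph_mono[OF assms, of \<eta>]
    by (intro continuous_map_into_subtopology continuous_map_from_subtopology continuous_map_id)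
       (simp add: Pi_def subset_iff)
  moreover have "continuous_map (?G J) (kronecker_leaf J \<eta> p) ?f"
    unfolding kronecker_leaf_def
    by (rule quotient_imp_continuous_map[OF quotient_map_quotient_topology])
  ultimately have "continuous_map (?G I) (kronecker_leaf J \<eta> p) (?f \<circ> id)"
    by (rule continuous_map_compose)
  then have "continuous_map (?G I) (kronecker_leaf J \<eta> p) (id \<circ> ?f)"
    by simp
  then show ?thesis
    unfolding kronecker_leaf_def[of I]
    by (rule continuous_compose_quotient_map[OF quotient_map_quotient_topology])
qed

lemma kronecker_leaf_subset_torus1:
  assumes "p \<in> torus1 I"
  shows "topspace (kronecker_leaf I \<eta> p) \<subseteq> torus1 I"
proof
  fix q assume "q \<in> topspace (kronecker_leaf I \<eta> p)"
  then obtain y where y: "y \<in> kronecker_graph I \<eta>" and q: "q = (\<lambda>j. p j + to_circle (y j))"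
    unfolding topspace_kronecker_leaf by (rule imageE)
  have "\<forall>j. j \<notin> labels1 I \<longrightarrow> y j = 0"
    using subsetD[OF kronecker_graph_subset y] by (simp add: topspace_coord_space)
  then show "q \<in> torus1 I"
    using assms by (simp add: q torus1_def)
qed


section \<open>The polynomial foliation\<close>

text \<open>
  \<open>'s \<Rightarrow>\<^sub>0 nat\<close> is the type of multi-indices and \<open>('s \<Rightarrow>\<^sub>0 nat) \<Rightarrow>\<^sub>0 rat\<close> the ring of
  polynomials over \<open>\<rat>\<close> in variables indexed by \<open>'s\<close>.
\<close>

definition total_degree :: "('s::finite \<Rightarrow>\<^sub>0 nat) \<Rightarrow> nat" where
  "total_degree m = (\<Sum>k\<in>UNIV. poly_mapping.lookup m k)"

definition monom_value :: "real ^ 's \<Rightarrow> ('s \<Rightarrow>\<^sub>0 nat) \<Rightarrow> real" where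
  "monom_value \<theta> m = (\<Prod>k\<in>UNIV. \<theta> $ k ^ poly_mapping.lookup m k)"

definition poly_value :: "real ^ 's \<Rightarrow> (('s \<Rightarrow>\<^sub>0 nat) \<Rightarrow>\<^sub>0 rat) \<Rightarrow> real" where
  "poly_value \<theta> P = (\<Sum>m\<in>Poly_Mapping.keys P. of_rat (poly_mapping.lookup P m) * monom_value \<theta> m)"

definition algebraically_independent :: "real ^ 's \<Rightarrow> bool" where
  "algebraically_independent \<theta> \<longleftrightarrow> (\<forall>P. poly_value \<theta> P = 0 \<longrightarrow> P = 0)"

definition monoms :: "nat \<Rightarrow> ('s::finite \<Rightarrow>\<^sub>0 nat) set" where
  "monoms d = {m. 0 < total_degree m \<and> total_degree m \<le> d}"

lemma finite_monoms: "finite (monoms d :: ('s::finite \<Rightarrow>\<^sub>0 nat) set)"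
proof -
  have "poly_mapping.lookup m k \<le> d" if "m \<in> monoms d" for m :: "'s \<Rightarrow>\<^sub>0 nat" and k
    using that member_le_sum[of k UNIV "poly_mapping.lookup m"]
    by (simp add: monoms_def total_degree_def)
  then have "poly_mapping.lookup ` (monoms d :: ('s \<Rightarrow>\<^sub>0 nat) set) \<subseteq> PiE UNIV (\<lambda>_. {..d})"
    by auto
  moreover have "finite (PiE (UNIV :: 's set) (\<lambda>_. {..d}))"
    by (intro finite_PiE) auto
  ultimately have "finite (poly_mapping.lookup ` (monoms d :: ('s \<Rightarrow>\<^sub>0 nat) set))"
    by (rule finite_subset)
  then show ?thesis
    by (rule finite_imageD) (simp add: inj_on_def)
qed

lemma monoms_mono: "d \<le> e \<Longrightarrow> monoms d \<subseteq> monoms e"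
  by (auto simp: monoms_def)

definition poly_param_space :: "(('s::finite \<Rightarrow>\<^sub>0 nat) \<Rightarrow> real) topology" where
  "poly_param_space = direct_limit {1..} (\<lambda>d. coord_space (monoms d))"

definition limit_torus :: "(('s::finite \<Rightarrow>\<^sub>0 nat) option \<Rightarrow> circle) set" where
  "limit_torus = (\<Union>d\<in>{1..}. torus1 (monoms d))"

text \<open>
  The leaf through \<open>p\<close> of the limit foliation is the direct limit of the leaves through \<open>p\<close>
  of those stages whose torus contains \<open>p\<close>.
\<close>

definition poly_leaf ::
    "real ^ 's \<Rightarrow> (('s::finite \<Rightarrow>\<^sub>0 nat) option \<Rightarrow> circle)
      \<Rightarrow> (('s \<Rightarrow>\<^sub>0 nat) option \<Rightarrow> circle) topology" where
  "poly_leaf \<theta> p =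
     direct_limit {d. 1 \<le> d \<and> p \<in> torus1 (monoms d)}
       (\<lambda>d. kronecker_leaf (monoms d) (monom_value \<theta>) p)"

lemma topspace_poly_leaf:
  assumes "p \<in> limit_torus"
  shows "topspace (poly_leaf \<theta> p) =
    (\<lambda>y j. p j + to_circle (y j)) ` (\<Union>d\<in>{1..}. kronecker_graph (monoms d) (monom_value \<theta>))"
    (is "_ = ?f ` (\<Union>d\<in>{1..}. ?G d)")
proof -
  obtain d0 where d0: "1 \<le> d0" "p \<in> torus1 (monoms d0)"
    using assms by (auto simp: limit_torus_def)
  have "\<exists>e\<in>{d. 1 \<le> d \<and> p \<in> torus1 (monoms d)}. ?G d \<subseteq> ?G e" for d
  proof (intro bexI)
    show "?G d \<subseteq> ?G (max d d0)"
      by (intro kronecker_graph_mono monoms_mono finite_monoms) simp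
    have "monoms d0 \<subseteq> (monoms (max d d0) :: ('a \<Rightarrow>\<^sub>0 nat) set)"
      by (intro monoms_mono) simp
    then have "labels1 (monoms d0) \<subseteq> labels1 (monoms (max d d0) :: ('a \<Rightarrow>\<^sub>0 nat) set)"
      unfolding labels1_def by blast
    then show "max d d0 \<in> {d. 1 \<le> d \<and> p \<in> torus1 (monoms d)}"
      using d0 unfolding torus1_def by auto
  qed
  then have "(\<Union>d\<in>{1..}. ?G d) \<subseteq> (\<Union>d\<in>{d. 1 \<le> d \<and> p \<in> torus1 (monoms d)}. ?G d)"
    by (intro UN_least) (meson SUP_upper2)
  moreover have "(\<Union>d\<in>{d. 1 \<le> d \<and> p \<in> torus1 (monoms d)}. ?G d) \<subseteq> (\<Union>d\<in>{1..}. ?G d)"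
    by (rule UN_mono) auto
  ultimately have "(\<Union>d\<in>{d. 1 \<le> d \<and> p \<in> torus1 (monoms d)}. ?G d) = (\<Union>d\<in>{1..}. ?G d)"
    by (intro subset_antisym)
  then show ?thesis
    by (simp only: poly_leaf_def topspace_direct_limit topspace_kronecker_leaf image_UN[symmetric])
qed

definition poly_foliation ::
    "real ^ 's \<Rightarrow> (('s::finite \<Rightarrow>\<^sub>0 nat) option \<Rightarrow> circle) topology set" where
  "poly_foliation \<theta> = poly_leaf \<theta> ` limit_torus"

definition has_planar_leaves :: "(('s::finite \<Rightarrow>\<^sub>0 nat) option \<Rightarrow> circle) topology set \<Rightarrow> bool" where
  "has_planar_leaves F \<longleftrightarrow>
     (\<forall>X\<in>F. X homeomorphic_space (poly_param_space :: (('s \<Rightarrow>\<^sub>0 nat) \<Rightarrow> real) topology))"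

end

theory Submission
  imports Defs
begin

text \<open>
  Write \<open>V\<close> for the direct limit of the spaces \<open>\<real>\<^bsup>N(d)\<^esup>\<close>. Each leaf is a quotient of \<open>V\<close>: at a
  finite stage the graph is a copy of \<open>\<real>\<^bsup>N(d)\<^esup>\<close> and the leaf carries the quotient topology from the
  graph, and quotient maps pass to direct limits (\<open>quotient_map_poly_leaf\<close>). Two parameters give
  the same point of a leaf exactly when their difference is a \<^emph>\<open>period\<close>, that is, an integer vector
  \<open>k\<close> for which the slope vector pairs to an integer with \<open>k\<close>. Since the slopes are the values of
  the nonconstant monomials, a nonzero period is the same thing as a polynomial relation over \<open>\<int>\<close>,
  and clearing denominators turns any relation over \<open>\<rat>\<close> into one
  (\<open>algebraically_independent_iff_no_periods\<close>).

  If \<open>\<theta>\<close> is algebraically independent, there are no nonzero periods, so every one of these quotient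
  maps is injective and hence a homeomorphism.

  If there is a nonzero period \<open>k\<close>, the segment from \<open>0\<close> to \<open>k\<close> closes up to a loop in the leaf
  through \<open>0\<close>. Choose a coordinate \<open>m\<close> with \<open>k m \<noteq> 0\<close>. The \<open>m\<close>-th circle coordinate is continuous on
  the leaf and winds \<open>k m\<close> times along this loop. On the other hand, along a loop in \<open>V\<close> every
  continuous function into the punctured plane has a continuous logarithm that closes up
  (\<open>loop_logarithm_poly_param_space\<close>), because the loop lies in a finite stage and can be shrunk
  there to the origin. So this leaf is not homeomorphic to \<open>V\<close>.
\<close>

section \<open>Direct limits\<close>

text \<open>
  Both limits have the final topology, and the trace on a stage of the preimage of a set is the
  preimage of its trace. So openness can be compared stage by stage.
\<close>

lemma quotient_map_direct_limit:
  assumes q: "\<And>k. k \<in> A \<Longrightarrow> quotient_map (X k) (Y k) f"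
  shows "quotient_map (direct_limit A X) (direct_limit A Y) f"
  unfolding quotient_map_def
proof (intro conjI allI impI)
  have im: "f ` topspace (X k) = topspace (Y k)" if "k \<in> A" for k
    using q[OF that] by (simp add: quotient_map_def)
  show "f ` topspace (direct_limit A X) = topspace (direct_limit A Y)"
    by (auto simp: image_UN im)
  fix U assume U: "U \<subseteq> topspace (direct_limit A Y)"
  let ?V = "{x \<in> topspace (direct_limit A X). f x \<in> U}"
  have "openin (X k) (?V \<inter> topspace (X k)) \<longleftrightarrow> openin (Y k) (U \<inter> topspace (Y k))"
    if k: "k \<in> A" for k
  proof -
    have "?V \<inter> topspace (X k) = {x \<in> topspace (X k). f x \<in> U \<inter> topspace (Y k)}"
      using k im[OF k] by auto
    moreover have "U \<inter> topspace (Y k) \<subseteq> topspace (Y k)"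
      by simp
    ultimately show ?thesis
      using q[OF k] unfolding quotient_map_def by metis
  qed
  then show "openin (direct_limit A X) ?V = openin (direct_limit A Y) U"
    using U unfolding openin_direct_limit by auto
qed

lemma continuous_map_from_direct_limit:
  assumes "\<And>k. k \<in> A \<Longrightarrow> continuous_map (X k) Y f"
  shows "continuous_map (direct_limit A X) Y f"
  unfolding continuous_map_def
proof (intro conjI allI impI)
  show "f \<in> topspace (direct_limit A X) \<rightarrow> topspace Y"
    using assms by (auto simp: continuous_map_def)
  fix U assume U: "openin Y U"
  have "{x \<in> topspace (direct_limit A X). f x \<in> U} \<inter> topspace (X k)
      = {x \<in> topspace (X k). f x \<in> U}" if "k \<in> A" for k
    using that by auto
  then show "openin (direct_limit A X) {x \<in> topspace (direct_limit A X). f x \<in> U}"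
    using U assms unfolding openin_direct_limit by (auto simp: continuous_map_def)
qed

lemma continuous_map_into_direct_limit:
  assumes k: "k \<in> A" and f: "continuous_map Z (X k) f"
  shows "continuous_map Z (direct_limit A X) f"
proof -
  have "continuous_map (X k) (direct_limit A X) id"
    unfolding continuous_map_def
  proof (intro conjI allI impI)
    show "id \<in> topspace (X k) \<rightarrow> topspace (direct_limit A X)"
      using k by auto
    fix U assume "openin (direct_limit A X) U"
    moreover have "{x \<in> topspace (X k). id x \<in> U} = U \<inter> topspace (X k)"
      by auto
    ultimately show "openin (X k) {x \<in> topspace (X k). id x \<in> U}"
      using k by (simp add: openin_direct_limit)
  qed
  from continuous_map_compose[OF f this] show ?thesis
    by simp
qed

text \<open>
  A leaf through \<open>p\<close> is a limit over the stages whose torus contains \<open>p\<close>, the parameter space a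
  limit over all stages; this lemma lets the two be compared.
\<close>

lemma direct_limit_cofinal:
  assumes "B \<subseteq> A"
    and cofinal: "\<And>k. k \<in> A \<Longrightarrow> \<exists>l\<in>B. topspace (X k) \<subseteq> topspace (X l)
                    \<and> X k = subtopology (X l) (topspace (X k))"
  shows "direct_limit A X = direct_limit B X"
proof -
  have top: "(\<Union>k\<in>A. topspace (X k)) = (\<Union>k\<in>B. topspace (X k))"
    using assms by (fastforce intro!: subset_antisym)
  have "openin (X k) (U \<inter> topspace (X k))"
    if U: "\<forall>l\<in>B. openin (X l) (U \<inter> topspace (X l))" and k: "k \<in> A" for U k
  proof -
    obtain l where l: "l \<in> B" and sub: "topspace (X k) \<subseteq> topspace (X l)"
      and eq: "X k = subtopology (X l) (topspace (X k))"
      using cofinal[OF k] by blast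
    have "openin (subtopology (X l) (topspace (X k))) ((U \<inter> topspace (X l)) \<inter> topspace (X k))"
      using U l by (intro openin_subtopology_Int) auto
    then show ?thesis
      using sub eq by (simp add: Int_assoc Int_absorb1)
  qed
  then show ?thesis
    using \<open>B \<subseteq> A\<close> unfolding topology_eq openin_direct_limit top by (meson subsetD)
qed

text \<open>
  Otherwise the compact set contains a point \<open>x k\<close> outside each stage \<open>k\<close>. Only finitely many of these
  points lie in a given stage, where finite sets are closed. Removing the tail of the sequence
  \<open>x\<close> from \<open>k\<close> on therefore leaves an open set, and these open sets cover everything, although no
  finite number of them covers the compact set.
\<close>

lemma compactin_direct_limit_in_stage:
  fixes X :: "nat \<Rightarrow> 'a topology"
  assumes K: "compactin (direct_limit A X) K" and "A \<noteq> {}"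
    and mono: "\<And>k l. k \<le> l \<Longrightarrow> topspace (X k) \<subseteq> topspace (X l)"
    and t1: "\<And>k. k \<in> A \<Longrightarrow> t1_space (X k)"
  obtains k where "k \<in> A" "K \<subseteq> topspace (X k)"
proof (rule ccontr)
  assume "\<not> thesis"
  then have "\<forall>k\<in>A. \<exists>x. x \<in> K \<and> x \<notin> topspace (X k)"
    using that by blast
  then obtain x where xK: "\<And>k. k \<in> A \<Longrightarrow> x k \<in> K"
    and x: "\<And>k. k \<in> A \<Longrightarrow> x k \<notin> topspace (X k)"
    by metis
  \<comment> \<open>The stages increase, so a stage contains only points with smaller index.\<close>
  have early: "m < k" if "m \<in> A" "x m \<in> topspace (X k)" for m k
    using x[OF that(1)] mono[of k m] that(2) by (meson linorder_not_le subsetD)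
  define U where "U k = topspace (direct_limit A X) - x ` {m\<in>A. k \<le> m}" for k
  have "openin (direct_limit A X) (U n)" for n
    unfolding openin_direct_limit
  proof (intro conjI ballI)
    show "U n \<subseteq> (\<Union>k\<in>A. topspace (X k))"
      by (auto simp: U_def)
    fix k assume k: "k \<in> A"
    let ?S = "x ` {m\<in>A. n \<le> m} \<inter> topspace (X k)"
    have "?S \<subseteq> x ` {..<k}"
      using early by auto
    then have "finite ?S"
      by (rule finite_subset) simp
    then have "closedin (X k) ?S"
      using t1[OF k] by (auto simp: t1_space_closedin_finite)
    then have "openin (X k) (topspace (X k) - ?S)"
      by (rule openin_diff[OF openin_topspace])
    moreover have "U n \<inter> topspace (X k) = topspace (X k) - ?S"
      using k by (auto simp: U_def)
    ultimately show "openin (X k) (U n \<inter> topspace (X k))"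
      by simp
  qed
  moreover have "K \<subseteq> \<Union> (U ` A)"
  proof
    fix y assume "y \<in> K"
    then have y: "y \<in> topspace (direct_limit A X)"
      using K compactin_subset_topspace by blast
    then obtain k where k: "k \<in> A" "y \<in> topspace (X k)"
      by auto
    then have "y \<in> U k"
      using y early unfolding U_def by fastforce
    then show "y \<in> \<Union> (U ` A)"
      using k by blast
  qed
  ultimately obtain F where F: "finite F" "F \<subseteq> A" "K \<subseteq> \<Union> (U ` F)"
    using K unfolding compactin_def by (metis (no_types, lifting) finite_subset_image imageE)
  have "F \<noteq> {}"
    using F xK \<open>A \<noteq> {}\<close> by auto
  then have M: "Max F \<in> A"
    using F Max_in by blast
  obtain k where k: "k \<in> F" "x (Max F) \<in> U k"
    using F(3) xK[OF M] by auto
  moreover have "k \<le> Max F"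
    using F k by simp
  ultimately show False
    using M by (auto simp: U_def)
qed


section \<open>The parameter space\<close>

lemma coord_space_subtopology:
  assumes "I \<subseteq> J"
  shows "coord_space I = subtopology (coord_space J) (topspace (coord_space I))"
proof -
  have "topspace (coord_space I) \<subseteq> topspace (coord_space J)"
    using assms by (auto simp: topspace_coord_space)
  then show ?thesis
    unfolding coord_space_def subtopology_subtopology
    by (simp add: topspace_coord_space Int_absorb1 flip: coord_space_def)
qed

lemma continuous_map_into_coord_space:
  "continuous_map X (coord_space I) f \<longleftrightarrow>
     (\<forall>i. continuous_map X euclideanreal (\<lambda>x. f x i))
     \<and> (\<forall>x\<in>topspace X. \<forall>i. i \<notin> I \<longrightarrow> f x i = 0)"
  unfolding coord_space_def
  by (auto simp: continuous_map_in_subtopology continuous_map_componentwise_UNIV Pi_iff)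

lemma continuous_map_coord:
  "continuous_map (coord_space I) euclideanreal (\<lambda>x. x i)"
  using continuous_map_into_coord_space[of "coord_space I" I "\<lambda>x. x"] by simp

lemma t1_space_coord_space: "t1_space (coord_space I)"
  unfolding coord_space_def
  by (intro t1_space_subtopology Hausdorff_imp_t1_space)
     (simp add: Hausdorff_space_product_topology)

lemma total_degree_eq_0_iff: "total_degree m = 0 \<longleftrightarrow> m = 0"
  by (simp add: total_degree_def poly_mapping_eq_iff fun_eq_iff)

text \<open>
  The constant monomial is not a coordinate, whence the condition \<open>x 0 = 0\<close>.
\<close>

lemma topspace_poly_param_space:
  "topspace poly_param_space = {x. finite {m. x m \<noteq> 0} \<and> x 0 = 0}"
proof (intro subset_antisym subsetI)
  fix x :: "('a \<Rightarrow>\<^sub>0 nat) \<Rightarrow> real" assume "x \<in> topspace poly_param_space"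
  then obtain d where d: "\<forall>m. m \<notin> monoms d \<longrightarrow> x m = 0"
    by (auto simp: poly_param_space_def topspace_coord_space)
  then have "{m. x m \<noteq> 0} \<subseteq> monoms d"
    by auto
  moreover have "(0 :: 'a \<Rightarrow>\<^sub>0 nat) \<notin> monoms d"
    by (simp add: monoms_def total_degree_eq_0_iff)
  ultimately show "x \<in> {x. finite {m. x m \<noteq> 0} \<and> x 0 = 0}"
    using d finite_monoms finite_subset by blast
next
  fix x :: "('a \<Rightarrow>\<^sub>0 nat) \<Rightarrow> real" assume x: "x \<in> {x. finite {m. x m \<noteq> 0} \<and> x 0 = 0}"
  let ?d = "Max (insert 1 (total_degree ` {m. x m \<noteq> 0}))"
  have "m \<in> monoms ?d" if "x m \<noteq> 0" for m
    using that x total_degree_eq_0_iff[of m] by (cases "m = 0") (auto simp: monoms_def)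
  moreover have "1 \<le> ?d"
    using x by simp
  ultimately show "x \<in> topspace poly_param_space"
    unfolding poly_param_space_def topspace_direct_limit topspace_coord_space
    by (intro UN_I[of ?d]) auto
qed

lemma continuous_map_poly_param_coord:
  "continuous_map poly_param_space euclideanreal (\<lambda>x. x m)"
  unfolding poly_param_space_def by (intro continuous_map_from_direct_limit continuous_map_coord)


section \<open>Parametrizing the leaves\<close>

text \<open>
  Summing over the support of \<open>x\<close>, rather than over a set of labels, gives one formula that is valid at
  every finite stage and hence on the limit.
\<close>

definition graph_point :: "('i \<Rightarrow> real) \<Rightarrow> ('i \<Rightarrow> real) \<Rightarrow> 'i option \<Rightarrow> real" where
  "graph_point \<eta> x = case_option (\<Sum>i | x i \<noteq> 0. \<eta> i * x i) x"

definition leaf_param ::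
    "('i \<Rightarrow> real) \<Rightarrow> ('i option \<Rightarrow> circle) \<Rightarrow> ('i \<Rightarrow> real) \<Rightarrow> ('i option \<Rightarrow> circle)" where
  "leaf_param \<eta> p x = (\<lambda>j. p j + to_circle (graph_point \<eta> x j))"

lemma sum_support:
  fixes \<eta> :: "'i \<Rightarrow> real"
  assumes "finite I" "\<And>i. i \<notin> I \<Longrightarrow> x i = 0"
  shows "(\<Sum>i | x i \<noteq> 0. \<eta> i * x i) = (\<Sum>i\<in>I. \<eta> i * x i)"
  using assms by (intro sum.mono_neutral_left) auto

text \<open>
  The graph is homeomorphic to its domain, and the leaf is by definition a quotient of the graph.
\<close>

lemma quotient_map_leaf_param:
  assumes "finite I"
  shows "quotient_map (coord_space I) (kronecker_leaf I \<eta> p) (leaf_param \<eta> p)"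
proof -
  let ?g = "\<lambda>x. case_option (\<Sum>i\<in>I. \<eta> i * x i) x"
  let ?G = "subtopology (coord_space (labels1 I)) (kronecker_graph I \<eta>)"
  have g: "graph_point \<eta> x = ?g x" if "x \<in> topspace (coord_space I)" for x
    using that assms by (simp add: graph_point_def topspace_coord_space sum_support)
  have cont: "continuous_map (coord_space I) euclideanreal (\<lambda>x. ?g x j)" for j
    using assms by (cases j) (auto intro!: continuous_intros continuous_map_coord)
  have "homeomorphic_maps (coord_space I) ?G ?g (\<lambda>y. y \<circ> Some)"
    unfolding homeomorphic_maps_def
  proof (intro conjI ballI)
    show "continuous_map (coord_space I) ?G ?g"
      unfolding continuous_map_in_subtopology continuous_map_into_coord_space
      using cont
      by (auto simp: kronecker_graph_def labels1_def topspace_coord_space split: option.splits)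
    show "continuous_map ?G (coord_space I) (\<lambda>y. y \<circ> Some)"
      unfolding continuous_map_into_coord_space
    proof (intro conjI)
      show "\<forall>i. continuous_map ?G euclideanreal (\<lambda>y. (y \<circ> Some) i)"
        by (auto simp: o_def intro!: continuous_map_from_subtopology continuous_map_coord)
      show "\<forall>y\<in>topspace ?G. \<forall>i. i \<notin> I \<longrightarrow> (y \<circ> Some) i = 0"
        by (auto simp: topspace_coord_space labels1_def)
    qed
    show "?g (y \<circ> Some) = y" if "y \<in> topspace ?G" for y
      using that by (auto simp: kronecker_graph_def o_def)
  qed (simp add: o_def)
  then have "quotient_map (coord_space I) ?G ?g"
    by (auto simp: homeomorphic_maps_map homeomorphic_map_def)
  then have "quotient_map (coord_space I) (kronecker_leaf I \<eta> p) ((\<lambda>y j. p j + to_circle (y j)) \<circ> ?g)"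
    unfolding kronecker_leaf_def by (rule quotient_map_compose[OF _ quotient_map_quotient_topology])
  then show ?thesis
    by (rule quotient_map_eq) (simp add: leaf_param_def g)
qed

lemma quotient_map_poly_leaf:
  fixes \<theta> :: "real ^ 's"
  assumes "p \<in> limit_torus"
  shows "quotient_map poly_param_space (poly_leaf \<theta> p) (leaf_param (monom_value \<theta>) p)"
proof -
  let ?A = "{d. 1 \<le> d \<and> p \<in> torus1 (monoms d)}"
  obtain d0 where d0: "1 \<le> d0" "p \<in> torus1 (monoms d0)"
    using assms by (auto simp: limit_torus_def)
  have cofinal: "poly_param_space = direct_limit ?A (\<lambda>d. coord_space (monoms d :: ('s \<Rightarrow>\<^sub>0 nat) set))"
    unfolding poly_param_space_def
  proof (rule direct_limit_cofinal)
    fix d :: nat assume "d \<in> {1..}"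
    \<comment> \<open>From \<open>d0\<close> on, every torus contains \<open>p\<close>.\<close>
    let ?e = "max d d0"
    have "monoms d0 \<subseteq> (monoms ?e :: ('s \<Rightarrow>\<^sub>0 nat) set)" "monoms d \<subseteq> (monoms ?e :: ('s \<Rightarrow>\<^sub>0 nat) set)"
      by (intro monoms_mono; simp)+
    then have "p \<in> torus1 (monoms ?e)"
      and "topspace (coord_space (monoms d :: ('s \<Rightarrow>\<^sub>0 nat) set)) \<subseteq> topspace (coord_space (monoms ?e))"
      using d0(2) by (fastforce simp: torus1_def labels1_def, fastforce simp: topspace_coord_space)
    moreover have "coord_space (monoms d :: ('s \<Rightarrow>\<^sub>0 nat) set)
        = subtopology (coord_space (monoms ?e)) (topspace (coord_space (monoms d)))"
      by (rule coord_space_subtopology) fact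
    ultimately show "\<exists>e\<in>?A. topspace (coord_space (monoms d :: ('s \<Rightarrow>\<^sub>0 nat) set)) \<subseteq> topspace (coord_space (monoms e)) \<and>
        coord_space (monoms d :: ('s \<Rightarrow>\<^sub>0 nat) set)
          = subtopology (coord_space (monoms e)) (topspace (coord_space (monoms d)))"
      using d0(1) by (intro bexI[of _ ?e]) auto
  qed auto
  show ?thesis
    unfolding poly_leaf_def cofinal
    by (intro quotient_map_direct_limit quotient_map_leaf_param finite_monoms)
qed


section \<open>Periods\<close>

text \<open>
  These are the vectors that the graph sends into the integer lattice, which is the kernel of the
  projection to the torus.
\<close>

definition is_period :: "('i \<Rightarrow> real) \<Rightarrow> ('i \<Rightarrow> real) \<Rightarrow> bool" where
  "is_period \<eta> x \<longleftrightarrow> (\<forall>j. graph_point \<eta> x j \<in> \<int>)"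

lemma is_period_iff:
  "is_period \<eta> x \<longleftrightarrow> (\<forall>i. x i \<in> \<int>) \<and> (\<Sum>i | x i \<noteq> 0. \<eta> i * x i) \<in> \<int>"
  by (auto simp: is_period_def graph_point_def split: option.split)

lemma leaf_param_eq_iff:
  assumes "finite {i. x i \<noteq> 0}" "finite {i. y i \<noteq> 0}"
  shows "leaf_param \<eta> p x = leaf_param \<eta> p y \<longleftrightarrow> is_period \<eta> (\<lambda>i. x i - y i)"
proof -
  let ?I = "{i. x i \<noteq> 0} \<union> {i. y i \<noteq> 0}"
  have fin: "finite ?I"
    using assms by simp
  have "(\<Sum>i | x i - y i \<noteq> 0. \<eta> i * (x i - y i))
      = (\<Sum>i | x i \<noteq> 0. \<eta> i * x i) - (\<Sum>i | y i \<noteq> 0. \<eta> i * y i)"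
    using sum_support[OF fin, of x \<eta>] sum_support[OF fin, of y \<eta>]
      sum_support[OF fin, of "\<lambda>i. x i - y i" \<eta>]
    by (simp add: right_diff_distrib sum_subtractf)
  then have "graph_point \<eta> (\<lambda>i. x i - y i) j = graph_point \<eta> x j - graph_point \<eta> y j" for j
    by (cases j) (simp_all add: graph_point_def)
  then show ?thesis
    by (simp add: leaf_param_def fun_eq_iff to_circle_eq_iff is_period_def)
qed

lemma ex_common_denominator:
  fixes c :: "'a \<Rightarrow> rat"
  assumes "finite S"
  shows "\<exists>D::int. D > 0 \<and> (\<forall>m\<in>S. of_int D * c m \<in> \<int>)"
  using assms
proof (induction S rule: finite_induct)
  case empty
  show ?case by (intro exI[of _ 1]) simp
next
  case (insert a S)
  then obtain D :: int where D: "D > 0" "\<forall>m\<in>S. of_int D * c m \<in> \<int>"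
    by blast
  obtain u v where uv: "quotient_of (c a) = (u, v)"
    by fastforce
  have v: "v > 0" and ca: "c a = of_int u / of_int v"
    using uv quotient_of_denom_pos quotient_of_div by blast+
  have "of_int (v * D) * c m \<in> \<int>" if "m \<in> insert a S" for m
  proof (cases "m = a")
    case True
    have "of_int (v * D) * c m = (of_int (u * D) :: rat)"
      using v ca True by simp
    then show ?thesis by (metis Ints_of_int)
  next
    case False
    then have "of_int v * (of_int D * c m) \<in> \<int>"
      using that D by (metis Ints_mult Ints_of_int insertE)
    then show ?thesis by (simp add: mult.assoc)
  qed
  then show ?case
    using D v by (intro exI[of _ "v * D"]) auto
qed

lemma monom_value_0 [simp]: "monom_value \<theta> 0 = 1"
  by (simp add: monom_value_def)

text \<open>
  A period \<open>x\<close>, with the integer \<open>n\<close> as its last coordinate in the graph, is the polynomial with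
  coefficients \<open>x m\<close> and constant term \<open>- n\<close>, which vanishes at \<open>\<theta>\<close>. Conversely, the nonconstant
  coefficients of a vanishing polynomial, multiplied by a common denominator, form a period. If that
  period is \<open>0\<close>, the polynomial is constant, and then it is \<open>0\<close> because its value is.
\<close>

lemma algebraically_independent_iff_no_periods:
  "algebraically_independent \<theta> \<longleftrightarrow>
     (\<forall>x\<in>topspace poly_param_space. is_period (monom_value \<theta>) x \<longrightarrow> x = (\<lambda>_. 0))"
    (is "?L \<longleftrightarrow> ?R")
proof
  assume L: ?L
  show ?R
  proof (intro ballI impI)
    fix x assume x: "x \<in> topspace poly_param_space" and per: "is_period (monom_value \<theta>) x"
    have fin: "finite {m. x m \<noteq> 0}" and x0: "x 0 = 0"
      using x by (auto simp: topspace_poly_param_space)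
    obtain n :: int where n: "(\<Sum>m | x m \<noteq> 0. monom_value \<theta> m * x m) = of_int n"
      using per by (auto simp: is_period_iff elim: Ints_cases)
    have x_int: "x m = of_int \<lfloor>x m\<rfloor>" for m
      using per by (simp add: is_period_iff)
    \<comment> \<open>\<open>x\<close> vanishes at the constant monomial, which leaves room for the constant term \<open>- n\<close>.\<close>
    define c :: "_ \<Rightarrow> rat" where "c m = (if m = 0 then - of_int n else of_int \<lfloor>x m\<rfloor>)" for m
    have "{m. c m \<noteq> 0} \<subseteq> insert 0 {m. x m \<noteq> 0}"
      by (auto simp: c_def split: if_splits)
    then have finc: "finite {m. c m \<noteq> 0}"
      using fin by (meson finite.insertI finite_subset)
    define P where "P = Abs_poly_mapping c"
    have P: "poly_mapping.lookup P = c"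
      unfolding P_def using finc by simp
    have c_real: "of_rat (c m) = (if m = 0 then - of_int n else x m)" for m
      using x_int[of m] by (simp add: c_def of_rat_minus)
    have "poly_value \<theta> P = (\<Sum>m\<in>insert 0 {m. x m \<noteq> 0}. of_rat (c m) * monom_value \<theta> m)"
      unfolding poly_value_def P using fin
      by (intro sum.mono_neutral_left) (auto simp: in_keys_iff P c_def split: if_splits)
    also have "\<dots> = - of_int n + (\<Sum>m | x m \<noteq> 0. of_rat (c m) * monom_value \<theta> m)"
      using fin x0 by (simp add: c_real)
    also have "(\<Sum>m | x m \<noteq> 0. of_rat (c m) * monom_value \<theta> m)
        = (\<Sum>m | x m \<noteq> 0. monom_value \<theta> m * x m)"
      using x0 by (intro sum.cong) (auto simp: c_real)
    finally have "poly_value \<theta> P = 0"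
      using n by simp
    then have "P = 0"
      using L by (simp add: algebraically_independent_def)
    then have "c m = 0" for m
      using P by (metis lookup_zero)
    then show "x = (\<lambda>_. 0)"
      using c_real x0 by (metis of_rat_0)
  qed
next
  assume R: ?R
  show ?L
    unfolding algebraically_independent_def
  proof (intro allI impI)
    fix P assume P: "poly_value \<theta> P = 0"
    let ?c = "poly_mapping.lookup P"
    obtain D :: int where D: "D > 0" "\<forall>m\<in>Poly_Mapping.keys P. of_int D * ?c m \<in> \<int>"
      using ex_common_denominator[of "Poly_Mapping.keys P" ?c] by auto
    have D': "of_int D * ?c m \<in> \<int>" for m
      using D(2) by (cases "m \<in> Poly_Mapping.keys P") (auto simp: in_keys_iff)
    define y :: "_ \<Rightarrow> real" where "y m = of_int D * of_rat (?c m)" for m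
    have y_int: "y m \<in> \<int>" for m
    proof -
      obtain k :: int where "of_int D * ?c m = of_int k"
        using D' by (rule Ints_cases)
      then have "real_of_rat (of_int D * ?c m) = of_int k"
        by simp
      then show ?thesis
        by (simp add: y_def of_rat_mult)
    qed
    define x where "x = y(0 := 0)"
    have sub: "{m. x m \<noteq> 0} \<subseteq> Poly_Mapping.keys P - {0}"
      by (auto simp: x_def y_def in_keys_iff)
    have "(\<Sum>m\<in>Poly_Mapping.keys P. monom_value \<theta> m * y m) = of_int D * poly_value \<theta> P"
      by (simp add: y_def poly_value_def sum_distrib_left mult_ac)
    moreover have "(\<Sum>m\<in>Poly_Mapping.keys P. monom_value \<theta> m * y m)
        = (\<Sum>m\<in>insert 0 (Poly_Mapping.keys P). monom_value \<theta> m * y m)"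
      by (intro sum.mono_neutral_left) (auto simp: y_def in_keys_iff)
    moreover have "\<dots> = y 0 + (\<Sum>m\<in>Poly_Mapping.keys P - {0}. monom_value \<theta> m * y m)"
      by (simp add: sum.insert_remove)
    moreover have "(\<Sum>m\<in>Poly_Mapping.keys P - {0}. monom_value \<theta> m * y m)
        = (\<Sum>m | x m \<noteq> 0. monom_value \<theta> m * x m)"
      using sub by (subst sum_support[where I = "Poly_Mapping.keys P - {0}"])
        (auto simp: x_def y_def in_keys_iff intro!: sum.cong)
    ultimately have rel: "(\<Sum>m | x m \<noteq> 0. monom_value \<theta> m * x m) = - y 0"
      using P by simp
    have "is_period (monom_value \<theta>) x"
      unfolding is_period_iff rel using y_int by (simp add: x_def)
    moreover have "x \<in> topspace poly_param_space"
      using finite_subset[OF sub] by (simp add: topspace_poly_param_space x_def)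
    ultimately have x0: "x = (\<lambda>_. 0)"
      using R by blast
    then have "y 0 = 0"
      using rel by simp
    then have "y m = 0" for m
      using x0 unfolding x_def by (cases "m = 0") (metis fun_upd_other)+
    then have "?c m = 0" for m
      using D(1) by (simp add: y_def)
    then show "P = 0"
      by (simp add: poly_mapping_eq_iff fun_eq_iff)
  qed
qed


section \<open>Detecting loops\<close>

text \<open>
  Distinct complex numbers with exponential \<open>1\<close> are at least \<open>2 * pi\<close> apart, and the interval is
  connected.
\<close>

lemma exp_eq_1_const:
  fixes f :: "real \<Rightarrow> complex"
  assumes cont: "continuous_on {0..1} f" and f: "\<And>t. t \<in> {0..1} \<Longrightarrow> exp (f t) = 1"
    and t: "s \<in> {0..1}" "t \<in> {0..1}"
  shows "f s = f t"
proof -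
  have "f constant_on {0..1}"
  proof (rule continuous_discrete_range_constant[OF _ cont])
    fix a :: real assume a: "a \<in> {0..1}"
    have "2 * pi \<le> norm (f b - f a)" if b: "b \<in> {0..1}" "f b \<noteq> f a" for b
    proof -
      have "exp (f b - f a) = 1"
        using f[OF a] f[OF b(1)] by (simp add: exp_diff)
      then obtain n :: int where n: "Re (f b - f a) = 0" "Im (f b - f a) = of_int (2 * n) * pi"
        unfolding exp_eq_1 by blast
      then have "n \<noteq> 0"
        using b(2) by (auto simp: complex_eq_iff)
      then have "1 \<le> \<bar>real_of_int n\<bar>"
        by linarith
      then have "2 * pi \<le> \<bar>Im (f b - f a)\<bar>"
        by (simp only: n) (simp add: abs_mult)
      then show ?thesis
        using abs_Im_le_cmod order_trans by blast
    qed
    then show "\<exists>e>0. \<forall>b. b \<in> {0..1} \<and> f b \<noteq> f a \<longrightarrow> e \<le> norm (f b - f a)"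
      by (intro exI[of _ "2 * pi"]) auto
  qed simp
  then show ?thesis
    using t by (auto simp: constant_on_def)
qed

text \<open>
  This is the form in which simple connectedness of the parameter space is used. The loop is compact,
  so it lies in a finite stage. Scaling is continuous there, so \<open>(t, s) \<mapsto> f (s \<gamma>(t))\<close> is continuous on a
  square and has a logarithm \<open>G\<close>. The increment \<open>G (1, s) - G (0, s)\<close> is a multiple of \<open>2\<pi>\<i>\<close>, so it does
  not depend on \<open>s\<close>; at \<open>s = 0\<close> it vanishes, because \<open>f\<close> is evaluated at the origin only.
\<close>

lemma loop_logarithm_poly_param_space:
  fixes \<gamma> :: "real \<Rightarrow> ('s::finite \<Rightarrow>\<^sub>0 nat) \<Rightarrow> real"
  assumes \<gamma>: "continuous_map (top_of_set {0..1}) poly_param_space \<gamma>" and loop: "\<gamma> 0 = \<gamma> 1"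
    and f: "continuous_map poly_param_space euclidean f" and nz: "\<And>x. f x \<noteq> (0::complex)"
  obtains g where "continuous_on {0..1} g" "g 0 = g 1" "\<And>t. t \<in> {0..1} \<Longrightarrow> f (\<gamma> t) = exp (g t)"
proof -
  let ?Q = "{0..1::real} \<times> {0..1::real}"
  have "compactin poly_param_space (\<gamma> ` {0..1})"
    using \<gamma> by (intro image_compactin) (auto simp: compactin_subtopology)
  then obtain d :: nat where d: "1 \<le> d" "\<gamma> ` {0..1} \<subseteq> topspace (coord_space (monoms d))"
    unfolding poly_param_space_def
  proof (rule compactin_direct_limit_in_stage)
    show "topspace (coord_space (monoms k :: ('s \<Rightarrow>\<^sub>0 nat) set)) \<subseteq> topspace (coord_space (monoms l))"
      if "k \<le> l" for k l
      using monoms_mono[OF that] by (auto simp: topspace_coord_space)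
  qed (auto simp: t1_space_coord_space)
  have \<gamma>_coord: "continuous_on {0..1} (\<lambda>t. \<gamma> t m)" for m
    using continuous_map_compose[OF \<gamma> continuous_map_poly_param_coord[of m]] by (simp add: o_def)
  have "continuous_on ?Q (\<lambda>z. snd z * \<gamma> (fst z) m)" for m
    by (intro continuous_intros continuous_on_compose2[OF \<gamma>_coord]) auto
  then have "continuous_map (top_of_set ?Q) (coord_space (monoms d)) (\<lambda>z m. snd z * \<gamma> (fst z) m)"
    using d(2) by (auto simp: continuous_map_into_coord_space topspace_coord_space image_subset_iff)
  then have "continuous_map (top_of_set ?Q) poly_param_space (\<lambda>z m. snd z * \<gamma> (fst z) m)"
    unfolding poly_param_space_def using d(1) by (intro continuous_map_into_direct_limit) auto
  from continuous_map_compose[OF this f]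
  have "continuous_on ?Q (\<lambda>z. f (\<lambda>m. snd z * \<gamma> (fst z) m))"
    by (simp add: o_def)
  moreover have "contractible ?Q"
    by (intro convex_imp_contractible convex_Times) auto
  ultimately obtain G where G: "continuous_on ?Q G"
    and fG: "\<And>z. z \<in> ?Q \<Longrightarrow> f (\<lambda>m. snd z * \<gamma> (fst z) m) = exp (G z)"
    using nz by (rule continuous_logarithm_on_contractible) blast
  have G_t: "continuous_on {0..1} (\<lambda>t. G (t, s))" if "s \<in> {0..1}" for s
    using that by (intro continuous_on_compose2[OF G] continuous_intros) auto
  have G_s: "continuous_on {0..1} (\<lambda>s. G (t, s))" if "t \<in> {0..1}" for t
    using that by (intro continuous_on_compose2[OF G] continuous_intros) auto
  have "G (1, 1) - G (0, 1) = G (1, 0) - G (0, 0)"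
  proof (rule exp_eq_1_const[where f = "\<lambda>s. G (1, s) - G (0, s)"])
    show "exp (G (1, s) - G (0, s)) = 1" if "s \<in> {0..1}" for s
      using fG[of "(1, s)"] fG[of "(0, s)"] that loop by (simp add: exp_diff)
  qed (auto intro!: continuous_intros G_s)
  also have "\<dots> = G (0, 0) - G (0, 0)"
  proof (rule exp_eq_1_const[where f = "\<lambda>t. G (t, 0) - G (0, 0)"])
    show "exp (G (t, 0) - G (0, 0)) = 1" if "t \<in> {0..1}" for t
      using fG[of "(t, 0)"] fG[of "(0, 0)"] that by (simp add: exp_diff)
  qed (auto intro!: continuous_intros G_t)
  finally have "G (0, 1) = G (1, 1)"
    by simp
  then show thesis
    using fG[of "(_, 1)"] G_t[of 1] by (intro that[of "\<lambda>t. G (t, 1)"]) simp_all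
qed

lift_definition circle_exp :: "circle \<Rightarrow> complex" is "\<lambda>x. exp (2 * pi * \<i> * of_real x)"
proof -
  fix x y :: real assume "x - y \<in> \<int>"
  then obtain n where "x - y = of_int n"
    by (rule Ints_cases)
  then have "x = y + of_int n"
    by simp
  then show "exp (2 * pi * \<i> * of_real x) = exp (2 * pi * \<i> * of_real y)"
    by (auto simp: exp_eq intro!: exI[of _ n] simp: algebra_simps)
qed

lemma circle_exp_nonzero [simp]: "circle_exp z \<noteq> 0"
  by transfer simp

text \<open>
  The loop \<open>l\<close> is the image of the segment from \<open>0\<close> to the period \<open>k\<close>. If the leaf were homeomorphic to
  the parameter space, \<open>exp (2\<pi>\<i> t (k m))\<close>, the \<open>m\<close>-th coordinate along \<open>l\<close>, would have a logarithm with
  equal values at \<open>t = 0\<close> and \<open>t = 1\<close>. As it differs from \<open>2\<pi>\<i> t (k m)\<close> by a constant, \<open>k m = 0\<close>.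
\<close>

lemma no_periods_if_homeomorphic:
  fixes \<theta> :: "real ^ 's"
  assumes hom: "poly_leaf \<theta> (\<lambda>_. 0) homeomorphic_space (poly_param_space :: (('s \<Rightarrow>\<^sub>0 nat) \<Rightarrow> real) topology)"
    and k: "k \<in> topspace poly_param_space" and per: "is_period (monom_value \<theta>) k"
  shows "k = (\<lambda>_. 0)"
proof
  fix m :: "'s \<Rightarrow>\<^sub>0 nat"
  let ?X = "poly_leaf \<theta> (\<lambda>_. 0)" and ?q = "leaf_param (monom_value \<theta>) (\<lambda>_. 0)"
  have q: "quotient_map poly_param_space ?X ?q"
    by (rule quotient_map_poly_leaf) (auto simp: limit_torus_def torus1_def)
  obtain \<phi> :: "_ \<Rightarrow> ('s \<Rightarrow>\<^sub>0 nat) \<Rightarrow> real" and \<psi>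
    where \<phi>: "continuous_map ?X poly_param_space \<phi>" and \<psi>: "continuous_map poly_param_space ?X \<psi>"
    and \<psi>\<phi>: "\<And>z. z \<in> topspace ?X \<Longrightarrow> \<psi> (\<phi> z) = z"
    using hom unfolding homeomorphic_space_def homeomorphic_maps_def by blast
  have val: "circle_exp (?q x (Some m)) = exp (2 * pi * \<i> * of_real (x m))" for x
    by (simp add: leaf_param_def graph_point_def circle_exp.abs_eq)
  \<comment> \<open>The leaf is a quotient of the parameter space, so continuity of the coordinate on the leaf can be
    checked on parameters.\<close>
  have "continuous_map poly_param_space euclidean (\<lambda>x. exp (2 * pi * \<i> * of_real (x m)))"
    using continuous_map_compose[OF continuous_map_poly_param_coord[of m],
        of euclidean "\<lambda>r. exp (2 * pi * \<i> * of_real r)"]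
    by (simp add: o_def continuous_intros)
  then have "continuous_map ?X euclidean (\<lambda>z. circle_exp (z (Some m)))"
    by (intro continuous_compose_quotient_map[OF q]) (simp add: o_def val)
  then have f: "continuous_map poly_param_space euclidean (\<lambda>x. circle_exp (\<psi> x (Some m)))"
    using continuous_map_compose[OF \<psi>] by (simp add: o_def)
  obtain d :: nat where d: "1 \<le> d" "k \<in> topspace (coord_space (monoms d))"
    using k by (auto simp: poly_param_space_def)
  have "continuous_map (top_of_set {0..1}) (coord_space (monoms d)) (\<lambda>t m. t * k m)"
    using d(2) by (auto simp: continuous_map_into_coord_space topspace_coord_space intro!: continuous_intros)
  then have line: "continuous_map (top_of_set {0..1}) poly_param_space (\<lambda>t m. t * k m)"
    unfolding poly_param_space_def using d(1) by (intro continuous_map_into_direct_limit) auto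
  define l where "l t = ?q (\<lambda>m. t * k m)" for t
  have l: "continuous_map (top_of_set {0..1}) ?X l"
    using continuous_map_compose[OF line quotient_imp_continuous_map[OF q]]
    by (simp add: o_def l_def[abs_def])
  have "l 0 = l 1"
    using k per leaf_param_eq_iff[of k "\<lambda>_. 0" "monom_value \<theta>" "\<lambda>_. 0"]
    by (simp add: l_def topspace_poly_param_space)
  then obtain g where g: "continuous_on {0..1} g" "g 0 = g 1"
    and fg: "\<And>t. t \<in> {0..1} \<Longrightarrow> circle_exp (\<psi> ((\<phi> \<circ> l) t) (Some m)) = exp (g t)"
    using loop_logarithm_poly_param_space[OF continuous_map_compose[OF l \<phi>] _ f] by auto
  have "g 0 - 2 * pi * \<i> * of_real (0 * k m) = g 1 - 2 * pi * \<i> * of_real (1 * k m)"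
  proof (rule exp_eq_1_const[where f = "\<lambda>t. g t - 2 * pi * \<i> * of_real (t * k m)"])
    fix t :: real assume t: "t \<in> {0..1}"
    have "l t \<in> topspace ?X"
      using t l by (auto simp: continuous_map_def)
    then have "exp (g t) = circle_exp (l t (Some m))"
      using fg[OF t] \<psi>\<phi> by simp
    then show "exp (g t - 2 * pi * \<i> * of_real (t * k m)) = 1"
      by (simp add: l_def val exp_diff)
  qed (auto intro!: continuous_intros g)
  then show "k m = 0"
    using g(2) by simp
qed

theorem theorem20:
  fixes \<theta> :: "real ^ 's"
  shows "has_planar_leaves (poly_foliation \<theta>) \<longleftrightarrow> algebraically_independent \<theta>"
proof
  assume "has_planar_leaves (poly_foliation \<theta>)"
  moreover have "(\<lambda>_. 0) \<in> (limit_torus :: (('s \<Rightarrow>\<^sub>0 nat) option \<Rightarrow> circle) set)"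
    by (auto simp: limit_torus_def torus1_def)
  ultimately have "poly_leaf \<theta> (\<lambda>_. 0) homeomorphic_space (poly_param_space :: (('s \<Rightarrow>\<^sub>0 nat) \<Rightarrow> real) topology)"
    by (simp add: has_planar_leaves_def poly_foliation_def)
  then show "algebraically_independent \<theta>"
    unfolding algebraically_independent_iff_no_periods using no_periods_if_homeomorphic by blast
next
  assume indep: "algebraically_independent \<theta>"
  have "poly_leaf \<theta> p homeomorphic_space (poly_param_space :: (('s \<Rightarrow>\<^sub>0 nat) \<Rightarrow> real) topology)"
    if p: "p \<in> limit_torus" for p
  proof -
    let ?q = "leaf_param (monom_value \<theta>) p"
    have "inj_on ?q (topspace poly_param_space)"
    proof (rule inj_onI)
      fix x y assume x: "x \<in> topspace poly_param_space" and y: "y \<in> topspace poly_param_space"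
        and "?q x = ?q y"
      then have "is_period (monom_value \<theta>) (\<lambda>m. x m - y m)"
        using leaf_param_eq_iff by (auto simp: topspace_poly_param_space)
      moreover have "finite {m. x m - y m \<noteq> 0}"
        using x y by (intro finite_subset[of "{m. x m - y m \<noteq> 0}" "{m. x m \<noteq> 0} \<union> {m. y m \<noteq> 0}"])
          (auto simp: topspace_poly_param_space)
      then have "(\<lambda>m. x m - y m) \<in> topspace poly_param_space"
        using x y by (simp add: topspace_poly_param_space)
      ultimately have "(\<lambda>m. x m - y m) = (\<lambda>_. 0)"
        using indep by (simp add: algebraically_independent_iff_no_periods)
      then show "x = y"
        by (auto simp: fun_eq_iff)
    qed
    with quotient_map_poly_leaf[OF p, of \<theta>]
    have "homeomorphic_map poly_param_space (poly_leaf \<theta> p) ?q"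
      by (simp add: homeomorphic_map_def)
    then show ?thesis
      using homeomorphic_map_imp_homeomorphic_space homeomorphic_space_sym by blast
  qed
  then show "has_planar_leaves (poly_foliation \<theta>)"
    by (auto simp: has_planar_leaves_def poly_foliation_def)
qed

end
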